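(* Let $f:\mathbb{N}\to\mathbb{N}$ be a monotonically increasing function. Consider the one-pile game in which, in the $k$-th turn, the player must remove at least one and at most $f(k)$ stones, and the player who removes the last stone wins. Then the set $$\mathcal{P}^f=\bigcup_{k\in\mathbb{N}}\ \bigcup_{n\in\mathbb{Z}_{\ge 0}}\mathcal{P}^f_{k,n}$$ is exactly the set of $\mathcal{P}$-positions of this game.
   Context: $\mathbb{Z}_{\ge 0}$ is the set of non-negative integers and $\mathbb{N}=\{1,2,3,\dots\}$. Monotonically increasing means $f(a)\le f(b)$ whenever $a\le b$. The game: there is one pile of stones and two players alternately remove stones. Turns are numbered consecutively over both players. In the $k$-th turn the player to move must remove at least $1$ and at most $f(k)$ stones (and no more stones than are in the pile). The player who removes the last stone is the winner. A position is a pair $(x,k)$ with $x\in\mathbb{Z}_{\ge 0}$, $k\in\mathbb{N}$, meaning that the pile has $x$ stones and the $k$-th turn is about to be played. The positions reachable in one move from $(x,k)$ are $$\mathrm{move}(x,k)=\{(x-t,k+1): t\in\mathbb{N},\ 1\le t\le \min(x,f(k))\},$$ so that $\mathrm{move}(0,k)=\emptyset$. A position is a $\mathcal{P}$-position if the previous player (the player who just moved) wins from it under correct play at every stage, and an $\mathcal{N}$-position if the next player (the one about to move) wins from it under correct play at every stage. A position $(0,k)$ is a $\mathcal{P}$-position. For $n\in\mathbb{Z}_{\ge 0}$ and $k\in\mathbb{N}$, $$\mathcal{P}^f_{k,n}=\Big\{(x,k): x\in\mathbb{Z}_{\ge 0},\ \sum_{t=1}^n (f(k+2t-2)+1)\le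 x\le \sum_{t=1}^n (f(k+2t-1)+1)\Big\},$$ where empty sums are $0$; in particular $\mathcal{P}^f_{k,0}=\{(0,k)\}$. *)

theory Defs
  imports Main
begin

text \<open>A pair \<open>(x, k)\<close>: the pile has \<open>x\<close> stones and the \<open>k\<close>-th turn is about to be played.
  Turns are numbered from 1, so only pairs in \<open>positions\<close> are meaningful and the
  value \<open>f 0\<close> of the rule function never plays a role.\<close>
type_synonym position = "nat \<times> nat"

definition positions :: "position set" where
  "positions = {(x, k). 1 \<le> k}"

definition move :: "(nat \<Rightarrow> nat) \<Rightarrow> position \<Rightarrow> position set" where
  "move f = (\<lambda>(x, k). {(x - t, k + 1) | t. 1 \<le> t \<and> t \<le> min x (f k)})"

text \<open>The two players are named relative to the initial position of a play.\<close>
datatype player = Next_Player | Previous_Player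

text \<open>A play is the list of positions visited, run until no move is possible. Every
  play is finite, because the pile shrinks at each move.\<close>
definition complete_play :: "(nat \<Rightarrow> nat) \<Rightarrow> position \<Rightarrow> position list \<Rightarrow> bool" where
  "complete_play f p ps \<longleftrightarrow>
     ps \<noteq> [] \<and> hd ps = p \<and>
     (\<forall>i. i + 1 < length ps \<longrightarrow> ps ! (i + 1) \<in> move f (ps ! i)) \<and>
     move f (last ps) = {}"

definition to_move :: "nat \<Rightarrow> player" where
  "to_move i = (if even i then Next_Player else Previous_Player)"

text \<open>The winner made the last move, i.e. is the player who is not to move at the end.
  This includes the play of length one from an empty pile, won by the previous player.\<close>
definition won_by :: "player \<Rightarrow> position list \<Rightarrow> bool" where
  "won_by w ps \<longleftrightarrow> to_move (length ps - 1) \<noteq> w"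

text \<open>Strategies choose the next position. A position records the turn number, and the
  available moves depend on nothing else, so no further history is needed.\<close>
definition legal_strategy :: "(nat \<Rightarrow> nat) \<Rightarrow> (position \<Rightarrow> position) \<Rightarrow> bool" where
  "legal_strategy f \<sigma> \<longleftrightarrow> (\<forall>p \<in> positions. move f p \<noteq> {} \<longrightarrow> \<sigma> p \<in> move f p)"

definition follows :: "player \<Rightarrow> (position \<Rightarrow> position) \<Rightarrow> position list \<Rightarrow> bool" where
  "follows w \<sigma> ps \<longleftrightarrow>
     (\<forall>i. i + 1 < length ps \<longrightarrow> to_move i = w \<longrightarrow> ps ! (i + 1) = \<sigma> (ps ! i))"

text \<open>``Wins under correct play'': the player has a strategy that wins against every play
  of the opponent.\<close>
definition wins_from :: "(nat \<Rightarrow> nat) \<Rightarrow> player \<Rightarrow> position \<Rightarrow> bool" where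
  "wins_from f w p \<longleftrightarrow>
     (\<exists>\<sigma>. legal_strategy f \<sigma> \<and>
          (\<forall>ps. complete_play f p ps \<and> follows w \<sigma> ps \<longrightarrow> won_by w ps))"

definition P_positions :: "(nat \<Rightarrow> nat) \<Rightarrow> position set" where
  "P_positions f = {p \<in> positions. wins_from f Previous_Player p}"

text \<open>For \<open>k \<ge> 1\<close> and \<open>t \<ge> 1\<close>, the only case used, the subtractions do not truncate.\<close>
definition P_block :: "(nat \<Rightarrow> nat) \<Rightarrow> nat \<Rightarrow> nat \<Rightarrow> position set" where
  "P_block f k n =
     {(x, k) | x. (\<Sum>t = 1..n. (f (k + 2 * t - 2) + 1)) \<le> x \<and>
                  x \<le> (\<Sum>t = 1..n. (f (k + 2 * t - 1) + 1))}"

end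

theory Submission
  imports Defs
begin

text \<open>
  Write \<open>L k n = (f k + 1) + (f (k+2) + 1) + \<dots>\<close> (\<open>n\<close> summands) for the lower end of the
  \<open>n\<close>-th block at turn \<open>k\<close>. Its upper end is \<open>L (k+1) n\<close>, the lower end of the \<open>n\<close>-th block
  of the following turn, so a pile of \<open>x\<close> stones at turn \<open>k\<close> lies in the union of the blocks
  iff \<open>L k n \<le> x \<le> L (k+1) n\<close> for some \<open>n\<close>. Everything rests on the recursion
  \<open>L k (n+1) = f k + 1 + L (k+2) n\<close>, which relates this set at turn \<open>k\<close> to the gaps of the set
  at turn \<open>k+1\<close>:

  \<^item> A move takes at most \<open>f k\<close> stones, so from a pile in the block \<open>[L k (n+1), L (k+1) (n+1)]\<close>
    it ends strictly between \<open>L (k+2) n\<close> and \<open>L (k+1) (n+1)\<close>, that is, strictly between two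
    consecutive blocks of turn \<open>k+1\<close>. Block \<open>0\<close> is the empty pile and has no moves. So the
    set is stable.

  \<^item> A pile outside the set satisfies \<open>L (k+1) n < x < L k (n+1) = f k + 1 + L (k+2) n\<close> for
    some \<open>n\<close>, so it lies above the lower end of the block \<open>[L (k+1) n, L (k+2) n]\<close> of turn
    \<open>k+1\<close> and exceeds its upper end by at most \<open>f k\<close>. Monotonicity of \<open>f\<close> makes that block
    nonempty, hence some legal move enters it: the set is absorbing.

  A stable and absorbing set of positions (a kernel of the move graph) is the set of
  \<open>\<P>\<close>-positions. Whoever faces a position outside the kernel always moves into it; the opponent
  can only leave it again, and a play cannot end outside the kernel, so the opponent is the one
  who runs out of moves. The two players cannot both have winning strategies, because two
  strategies played against each other determine a single play.
\<close>

section \<open>Kernels of the move graph\<close>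

definition kernel :: "(nat \<Rightarrow> nat) \<Rightarrow> position set \<Rightarrow> bool" where
  "kernel f K \<longleftrightarrow>
     (\<forall>p \<in> positions. \<forall>q \<in> move f p. p \<in> K \<longrightarrow> q \<notin> K) \<and>
     (\<forall>p \<in> positions. p \<notin> K \<longrightarrow> move f p \<inter> K \<noteq> {})"

lemma move_in_positions: "q \<in> move f p \<Longrightarrow> q \<in> positions"
  by (cases p) (auto simp: move_def positions_def)

lemma move_decreases_pile: "q \<in> move f p \<Longrightarrow> fst q < fst p"
  by (cases p) (auto simp: move_def)

lemma to_move_Suc: "to_move (Suc i) = w \<longleftrightarrow> to_move i \<noteq> w"
  by (cases w) (auto simp: to_move_def)

lemma won_by_unique: "won_by v ps \<Longrightarrow> won_by w ps \<Longrightarrow> v = w"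
  by (cases v; cases w) (auto simp: won_by_def to_move_def split: if_splits)

lemma complete_play_Cons:
  assumes "q \<in> move f p" and "complete_play f q ps"
  shows "complete_play f p (p # ps)"
  using assms by (auto simp: complete_play_def nth_Cons hd_conv_nth split: nat.split)

text \<open>Prepending a position shifts every index by one and so exchanges the two players.\<close>
lemma follows_Cons:
  assumes "ps \<noteq> []" and "v \<noteq> w" and "follows v \<sigma> ps"
    and "w = Next_Player \<Longrightarrow> hd ps = \<sigma> p"
  shows "follows w \<sigma> (p # ps)"
  unfolding follows_def
proof (intro allI impI)
  fix i assume i: "i + 1 < length (p # ps)" "to_move i = w"
  show "(p # ps) ! (i + 1) = \<sigma> ((p # ps) ! i)"
  proof (cases i)
    case 0
    with i assms(1,4) show ?thesis by (simp add: to_move_def hd_conv_nth)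
  next
    case (Suc j)
    with i have "to_move j \<noteq> w" by (simp add: to_move_Suc)
    with assms(2) have "to_move j = v" by (metis player.exhaust)
    with Suc i assms(3) show ?thesis by (simp add: follows_def)
  qed
qed

text \<open>Pitting two strategies against each other yields a play that follows both. Since the
  roles of the players alternate along a play, the induction is over all pairs of strategies.\<close>
lemma ex_play_following_both:
  assumes "legal_strategy f \<sigma>" and "legal_strategy f \<tau>" and "p \<in> positions"
  shows "\<exists>ps. complete_play f p ps \<and> follows Next_Player \<sigma> ps \<and> follows Previous_Player \<tau> ps"
  using assms
proof (induction "fst p" arbitrary: p \<sigma> \<tau> rule: less_induct)
  case less
  show ?case
  proof (cases "move f p = {}")
    case True
    then show ?thesis
      by (intro exI[of _ "[p]"]) (simp add: complete_play_def follows_def)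
  next
    case False
    with less.prems have mv: "\<sigma> p \<in> move f p" by (simp add: legal_strategy_def)
    from less.hyps[OF move_decreases_pile[OF mv] less.prems(2,1) move_in_positions[OF mv]]
    obtain ps where ps: "complete_play f (\<sigma> p) ps"
      "follows Next_Player \<tau> ps" "follows Previous_Player \<sigma> ps" by blast
    then have "ps \<noteq> []" "hd ps = \<sigma> p" by (auto simp: complete_play_def)
    with ps have "follows Next_Player \<sigma> (p # ps)" "follows Previous_Player \<tau> (p # ps)"
      by (auto intro: follows_Cons)
    with complete_play_Cons[OF mv ps(1)] show ?thesis by blast
  qed
qed

lemma not_both_win:
  assumes "p \<in> positions"
  shows "\<not> (wins_from f Next_Player p \<and> wins_from f Previous_Player p)"
proof
  assume "wins_from f Next_Player p \<and> wins_from f Previous_Player p"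
  then obtain \<sigma> \<tau> where legal: "legal_strategy f \<sigma>" "legal_strategy f \<tau>"
    and win: "\<And>ps. complete_play f p ps \<Longrightarrow> follows Next_Player \<sigma> ps \<Longrightarrow> won_by Next_Player ps"
      "\<And>ps. complete_play f p ps \<Longrightarrow> follows Previous_Player \<tau> ps \<Longrightarrow> won_by Previous_Player ps"
    unfolding wins_from_def by blast
  from ex_play_following_both[OF legal assms] win won_by_unique show False by blast
qed

text \<open>The winner \<open>w\<close> is the player who does not face the kernel. Moving into the kernel whenever
  possible keeps the invariant that a visited position lies in the kernel iff \<open>w\<close> is not to
  move there. The last position has no moves, so it lies in the kernel by absorption, and it is
  the opponent who is stuck.\<close>
lemma kernel_strategy_wins:
  assumes K: "kernel f K" and p: "p \<in> positions" and w: "p \<in> K \<longleftrightarrow> w = Previous_Player"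
  shows "wins_from f w p"
proof -
  define \<sigma> where "\<sigma> q = (if move f q \<inter> K \<noteq> {} then SOME r. r \<in> move f q \<inter> K
                           else SOME r. r \<in> move f q)" for q
  have into_K: "\<sigma> q \<in> move f q \<inter> K" if "move f q \<inter> K \<noteq> {}" for q
  proof -
    from that have "\<sigma> q = (SOME r. r \<in> move f q \<inter> K)" by (simp add: \<sigma>_def)
    with that show ?thesis by (metis some_in_eq)
  qed
  have "\<sigma> q \<in> move f q" if "move f q \<noteq> {}" for q
  proof (cases "move f q \<inter> K = {}")
    case True
    then have "\<sigma> q = (SOME r. r \<in> move f q)" by (simp add: \<sigma>_def)
    with that show ?thesis by (metis some_in_eq)
  qed (use into_K in blast)
  then have legal: "legal_strategy f \<sigma>" by (simp add: legal_strategy_def)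
  have "won_by w ps" if play: "complete_play f p ps" and fol: "follows w \<sigma> ps" for ps
  proof -
    from play have ne: "ps \<noteq> []" and hd: "ps ! 0 = p" and fin: "move f (last ps) = {}"
      and step: "\<And>i. i + 1 < length ps \<Longrightarrow> ps ! (i + 1) \<in> move f (ps ! i)"
      by (auto simp: complete_play_def hd_conv_nth)
    have inv: "ps ! i \<in> positions \<and> (ps ! i \<in> K \<longleftrightarrow> to_move i \<noteq> w)" if "i < length ps" for i
      using that
    proof (induction i)
      case 0
      then show ?case using hd p w by (cases w) (auto simp: to_move_def)
    next
      case (Suc i)
      then have IH: "ps ! i \<in> positions" "ps ! i \<in> K \<longleftrightarrow> to_move i \<noteq> w" by auto
      from Suc.prems step have mv: "ps ! Suc i \<in> move f (ps ! i)" by simp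
      have "ps ! Suc i \<in> K \<longleftrightarrow> to_move i = w"
      proof (cases "to_move i = w")
        case True
        with fol Suc.prems have "ps ! Suc i = \<sigma> (ps ! i)" by (simp add: follows_def)
        with True IH K into_K show ?thesis by (auto simp: kernel_def)
      next
        case False
        with IH K mv show ?thesis by (auto simp: kernel_def)
      qed
      with move_in_positions[OF mv] show ?case by (simp add: to_move_Suc)
    qed
    from ne inv[of "length ps - 1"] have "last ps \<in> positions"
      "last ps \<in> K \<longleftrightarrow> to_move (length ps - 1) \<noteq> w" by (auto simp: last_conv_nth)
    with K fin show ?thesis by (auto simp: kernel_def won_by_def)
  qed
  with legal show ?thesis unfolding wins_from_def by blast
qed

theorem kernel_eq_P_positions:
  assumes "kernel f K" and "K \<subseteq> positions"
  shows "K = P_positions f"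
proof -
  have "p \<in> K \<longleftrightarrow> wins_from f Previous_Player p" if "p \<in> positions" for p
    using kernel_strategy_wins[OF assms(1) that] not_both_win[OF that] by blast
  with assms(2) show ?thesis by (auto simp: P_positions_def)
qed

section \<open>The blocks form a kernel\<close>

definition block_start :: "(nat \<Rightarrow> nat) \<Rightarrow> nat \<Rightarrow> nat \<Rightarrow> nat" where
  "block_start f k n = (\<Sum>i<n. f (k + 2 * i) + 1)"

lemma mem_P_block:
  "(x, j) \<in> P_block f k n \<longleftrightarrow> j = k \<and> block_start f k n \<le> x \<and> x \<le> block_start f (k + 1) n"
proof -
  have "(\<Sum>t = 1..n. f (k + 2 * t - 2) + 1) = block_start f k n"
    "(\<Sum>t = 1..n. f (k + 2 * t - 1) + 1) = block_start f (k + 1) n"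
    by (simp_all only: block_start_def One_nat_def sum.atLeast1_atMost_eq) (simp_all add: add.commute)
  then show ?thesis by (auto simp: P_block_def)
qed

lemma block_start_0: "block_start f k 0 = 0"
  by (simp add: block_start_def)

lemma block_start_Suc: "block_start f k (Suc n) = f k + 1 + block_start f (k + 2) n"
  by (simp add: block_start_def sum.lessThan_Suc_shift algebra_simps del: sum.lessThan_Suc)

lemma block_start_mono: "m \<le> n \<Longrightarrow> block_start f k m \<le> block_start f k n"
  unfolding block_start_def by (intro sum_mono2) auto

lemma le_block_start: "n \<le> block_start f k n"
  by (induction n arbitrary: k) (auto simp: block_start_Suc intro: trans_le_add2)

lemma block_start_turn_mono:
  assumes "mono_on {1..} f" and "1 \<le> k"
  shows "block_start f k n \<le> block_start f (k + 1) n"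
  unfolding block_start_def using assms by (intro sum_mono add_mono mono_onD[OF assms(1)]) auto

text \<open>The last block starting at or below \<open>x\<close> must end below \<open>x\<close>.\<close>
lemma gap_outside_blocks:
  assumes "\<And>n. (x, k) \<notin> P_block f k n"
  obtains n where "block_start f (k + 1) n < x" and "x < block_start f k (Suc n)"
proof -
  have "x < block_start f k (Suc x)" using le_block_start[of "Suc x" f k] by simp
  then obtain n where n: "x < block_start f k (Suc n)" "\<And>m. m < n \<Longrightarrow> \<not> x < block_start f k (Suc m)"
    using exists_least_iff[of "\<lambda>n. x < block_start f k (Suc n)"] by blast
  have "block_start f k n \<le> x"
    using n(2) by (cases n) (auto simp: block_start_0 not_less)
  with assms[of n] have "block_start f (k + 1) n < x" by (simp add: mem_P_block)
  with n(1) that show thesis by blast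
qed

text \<open>Every move from the block \<open>Suc m\<close> of turn \<open>k\<close> lands in the gap between the blocks \<open>m\<close> and
  \<open>Suc m\<close> of turn \<open>k + 1\<close>.\<close>
lemma blocks_stable:
  assumes "(x, k) \<in> P_block f k n" and "(y, j) \<in> move f (x, k)"
  shows "(y, j) \<notin> P_block f j l"
proof
  from assms(2) have j: "j = k + 1" and y: "y < x" "x \<le> y + f k" by (auto simp: move_def)
  from assms(1) have x: "block_start f k n \<le> x" "x \<le> block_start f (k + 1) n"
    by (auto simp: mem_P_block)
  with y obtain m where m: "n = Suc m" by (cases n) (auto simp: block_start_0)
  assume "(y, j) \<in> P_block f j l"
  with j have l: "block_start f (k + 1) l \<le> y" "y \<le> block_start f (k + 2) l"
    by (auto simp: mem_P_block)
  show False
  proof (cases "l \<le> m")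
    case True
    have "block_start f (k + 2) m < y" using x y by (simp add: m block_start_Suc)
    with block_start_mono[OF True, of f "k + 2"] l show False by simp
  next
    case False
    then have "block_start f (k + 1) n \<le> block_start f (k + 1) l"
      by (intro block_start_mono) (simp add: m)
    with x y l show False by simp
  qed
qed

lemma blocks_absorbing:
  assumes "1 \<le> f k" and "mono_on {1..} f" and "1 \<le> k" and "\<And>n. (x, k) \<notin> P_block f k n"
  obtains y n where "(y, k + 1) \<in> move f (x, k)" and "(y, k + 1) \<in> P_block f (k + 1) n"
proof -
  obtain n where lo: "block_start f (k + 1) n < x" and hi: "x < block_start f k (Suc n)"
    using gap_outside_blocks assms(4) by blast
  \<comment> \<open>Take as many stones as the turn allows without undershooting the target block.\<close>
  define y where "y = max (block_start f (k + 1) n) (x - f k)"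
  have "block_start f (k + 1) n \<le> block_start f (k + 2) n"
    using block_start_turn_mono[OF assms(2), of "k + 1" n] by simp
  then have "(y, k + 1) \<in> P_block f (k + 1) n"
    using hi by (auto simp: mem_P_block y_def block_start_Suc)
  moreover have "y < x" "x \<le> y + f k" using lo assms(1) by (auto simp: y_def)
  then have "(y, k + 1) \<in> move f (x, k)"
    by (auto simp: move_def intro!: exI[of _ "x - y"])
  ultimately show thesis using that by blast
qed

theorem theorem2p1:
  fixes f :: "nat \<Rightarrow> nat"
  assumes pos: "\<And>k. 1 \<le> k \<Longrightarrow> 1 \<le> f k"
    and mono: "mono_on {1..} f"
  shows "(\<Union>k \<in> {1..}. \<Union>n::nat. P_block f k n) = P_positions f"
proof (rule kernel_eq_P_positions)
  let ?K = "\<Union>k \<in> {1..}. \<Union>n. P_block f k n"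
  have mem: "(x, k) \<in> ?K \<longleftrightarrow> 1 \<le> k \<and> (\<exists>n. (x, k) \<in> P_block f k n)" for x k
    by (auto simp: mem_P_block)
  show "?K \<subseteq> positions" by (auto simp: P_block_def positions_def)
  show "kernel f ?K"
    unfolding kernel_def
  proof (intro conjI ballI impI)
    fix p q assume mv: "q \<in> move f p" and p: "p \<in> ?K"
    obtain x k y j where xy: "p = (x, k)" "q = (y, j)" by fastforce
    from p obtain n where "(x, k) \<in> P_block f k n" unfolding xy mem by blast
    from blocks_stable[OF this mv[unfolded xy]] show "q \<notin> ?K" unfolding xy mem by blast
  next
    fix p assume p: "p \<in> positions" "p \<notin> ?K"
    obtain x k where xk: "p = (x, k)" by fastforce
    with p have k: "1 \<le> k" and "\<And>n. (x, k) \<notin> P_block f k n"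
      unfolding xk mem by (auto simp: positions_def)
    then obtain y n where "(y, k + 1) \<in> move f (x, k)" "(y, k + 1) \<in> P_block f (k + 1) n"
      using blocks_absorbing[OF pos mono] by blast
    then have "(y, k + 1) \<in> move f p \<inter> ?K" unfolding xk Int_iff mem by auto
    then show "move f p \<inter> ?K \<noteq> {}" by blast
  qed
qed

end
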